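(* Let $\rho_{AB}$ be a density operator on $\mathbb{C}^d\otimes\mathbb{C}^d$ with ordered operator Schmidt coefficients $r_1\ge r_2\ge\dots\ge r_{d^2}\ge 0$. If $\sum_{i} r_i\le 1$, then $r_{d^2}\le r_{\mathrm{CN}}$, with $$r_{\mathrm{CN}}=\frac{d(d^2-1)-\sqrt{d^2-1}}{d(d^2-1)^2+d^3}<\frac{1}{d^2}.$$
   Context: The operator Schmidt coefficients of $\rho_{AB}$ are the $d^2$ singular values (counted with multiplicity, zeros included) of the correlation matrix $C_{ij}=\mathrm{Tr}\big((F_i\otimes G_j)^\dagger\rho_{AB}\big)$, where $\{F_i\}$ and $\{G_j\}$ are arbitrary bases of the space of linear operators on $\mathbb{C}^d$ that are orthonormal for the Hilbert–Schmidt inner product $\mathrm{Tr}(C^\dagger D)$; they do not depend on the choice of bases.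
   Formalization: The bound r_{d^2} ≤ r_CN is stated for d ≥ 3 only: it fails for d = 1 (r_1 = 1, r_CN = 0) and for d = 2 (an isotropic state has coefficients 1/2, 1/6, 1/6, 1/6, and r_CN < 1/6). The inequality r_CN < 1/d^2 is stated for all d ≥ 1. *)

theory Defs
  imports
    "Jordan_Normal_Form.Char_Poly"
    "Jordan_Normal_Form.Schur_Decomposition"
    "HOL-Computational_Algebra.Fundamental_Theorem_Algebra"
begin

definition mtrace :: "'a :: comm_monoid_add mat \<Rightarrow> 'a" where
  "mtrace A = (\<Sum>i<dim_row A. A $$ (i, i))"

text \<open>Kronecker product: the basis vector \<open>e\<^sub>i \<otimes> e\<^sub>k\<close> of the tensor product of two
  coordinate spaces has index \<open>i * n + k\<close>, with \<open>n\<close> the dimension of the second factor.\<close>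

definition kron :: "'a :: times mat \<Rightarrow> 'a mat \<Rightarrow> 'a mat" where
  "kron A B = mat (dim_row A * dim_row B) (dim_col A * dim_col B)
     (\<lambda>(i, j). A $$ (i div dim_row B, j div dim_col B) * B $$ (i mod dim_row B, j mod dim_col B))"

text \<open>The order on \<^typ>\<open>complex\<close> makes \<open>0 \<le> z\<close> say that \<open>z\<close> is real and nonnegative, so the
  positivity condition below includes that \<open>\<rho>\<close> is Hermitian.\<close>

definition density_operator :: "nat \<Rightarrow> complex mat \<Rightarrow> bool" where
  "density_operator n \<rho> \<longleftrightarrow>
     \<rho> \<in> carrier_mat n n \<and>
     (\<forall>v \<in> carrier_vec n. 0 \<le> (\<rho> *\<^sub>v v) \<bullet>c v) \<and>
     mtrace \<rho> = 1"

definition hs_inner :: "complex mat \<Rightarrow> complex mat \<Rightarrow> complex" where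
  "hs_inner C D = mtrace (mat_adjoint C * D)"

text \<open>The family is indexed by \<open>{..<d\<^sup>2}\<close>; its values elsewhere are irrelevant.
  The last conjunct says that it spans the \<open>d \<times> d\<close> matrices.\<close>

definition hs_orthonormal_basis :: "nat \<Rightarrow> (nat \<Rightarrow> complex mat) \<Rightarrow> bool" where
  "hs_orthonormal_basis d F \<longleftrightarrow>
     (\<forall>i<d\<^sup>2. F i \<in> carrier_mat d d) \<and>
     (\<forall>i<d\<^sup>2. \<forall>j<d\<^sup>2. hs_inner (F i) (F j) = (if i = j then 1 else 0)) \<and>
     (\<forall>A \<in> carrier_mat d d. \<exists>c. A = mat d d (\<lambda>(a, b). \<Sum>i<d\<^sup>2. c i * F i $$ (a, b)))"

definition correlation_mat ::
  "nat \<Rightarrow> (nat \<Rightarrow> complex mat) \<Rightarrow> (nat \<Rightarrow> complex mat) \<Rightarrow> complex mat \<Rightarrow> complex mat" where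
  "correlation_mat d F G \<rho> = mat (d\<^sup>2) (d\<^sup>2) (\<lambda>(i, j). hs_inner (kron (F i) (G j)) \<rho>)"

text \<open>Singular values in decreasing order: the square roots of the eigenvalues of \<open>A\<^sup>\<dagger> A\<close>, counted
  with algebraic multiplicity. These eigenvalues are real, so \<^const>\<open>Re\<close> discards nothing.\<close>

definition singular_values :: "complex mat \<Rightarrow> real list" where
  "singular_values A =
     rev (sorted_list_of_multiset
       (image_mset (\<lambda>z. sqrt (Re z)) (proots (char_poly (mat_adjoint A * A)))))"

definition op_schmidt_coeffs ::
  "nat \<Rightarrow> (nat \<Rightarrow> complex mat) \<Rightarrow> (nat \<Rightarrow> complex mat) \<Rightarrow> complex mat \<Rightarrow> real list" where
  "op_schmidt_coeffs d F G \<rho> = singular_values (correlation_mat d F G \<rho>)"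

text \<open>This bounds the least coefficient only for \<open>d \<ge> 3\<close>. For \<open>d = 2\<close> the isotropic state
  \<open>I / 6 + (e\<^sub>0\<^sub>0 + e\<^sub>1\<^sub>1) (e\<^sub>0\<^sub>0 + e\<^sub>1\<^sub>1)\<^sup>\<dagger> / 6\<close> has the coefficients \<open>1/2, 1/6, 1/6, 1/6\<close>, with sum \<open>1\<close>, and
  \<open>r_CN 2 = (6 - sqrt 3) / 26 < 1/6\<close>. For \<open>d = 1\<close> the only coefficient is \<open>1\<close>, and \<open>r_CN 1 = 0\<close>.\<close>

definition r_CN :: "nat \<Rightarrow> real" where
  "r_CN d = (real d * ((real d)\<^sup>2 - 1) - sqrt ((real d)\<^sup>2 - 1)) /
            (real d * ((real d)\<^sup>2 - 1)\<^sup>2 + (real d) ^ 3)"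

lemma mat_adjoint_index:
  "i < dim_col A \<Longrightarrow> j < dim_row A \<Longrightarrow> mat_adjoint A $$ (i, j) = conjugate (A $$ (j, i))"
  by (simp add: mat_adjoint_def mat_of_rows_index)

lemma length_singular_values: "length (singular_values A) = dim_col A"
proof -
  have "mat_adjoint A * A \<in> carrier_mat (dim_col A) (dim_col A)"
    by (auto simp: mat_adjoint_def)
  from degree_monic_char_poly[OF this] show ?thesis
    by (simp add: singular_values_def size_proots_complex flip: size_mset)
qed

lemma length_op_schmidt_coeffs: "length (op_schmidt_coeffs d F G \<rho>) = d\<^sup>2"
  by (simp add: op_schmidt_coeffs_def length_singular_values correlation_mat_def)

end

theory Submission
  imports Defs "Jordan_Normal_Form.Spectral_Radius"
begin

text \<open>Expanding the identity in both bases shows that the correlation matrix \<open>C\<close> satisfies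
  \<open>x\<^sup>* C y = Tr \<rho> = 1\<close> for vectors with \<open>\<parallel>x\<parallel>\<^sup>2 = \<parallel>y\<parallel>\<^sup>2 = d\<close>, so its largest singular value is at
  least \<open>1/d\<close>. If the singular values sum to at most \<open>1\<close>, the least one is therefore at most
  \<open>(1 - 1/d) / (d\<^sup>2 - 1) = 1 / (d (d + 1))\<close>, which is at most \<open>r\<^sub>C\<^sub>N\<close> once \<open>d \<ge> 3\<close>.

  That the largest eigenvalue of \<open>A\<^sup>\<dagger> A\<close> dominates every \<open>\<parallel>A v\<parallel>\<^sup>2 / \<parallel>v\<parallel>\<^sup>2\<close> is obtained without the spectral
  theorem: if \<open>A\<^sup>\<dagger> A\<close> has spectral radius less than \<open>1\<close>, its powers are bounded, whereas the
  ratios \<open>\<parallel>(A\<^sup>\<dagger> A)\<^sup>k\<^sup>+\<^sup>1 v\<parallel> / \<parallel>(A\<^sup>\<dagger> A)\<^sup>k v\<parallel>\<close> never fall below \<open>\<parallel>A v\<parallel>\<^sup>2 / \<parallel>v\<parallel>\<^sup>2\<close>.\<close>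

section \<open>The largest singular value\<close>

definition sq_norm_cvec :: "complex vec \<Rightarrow> real" where
  "sq_norm_cvec v = (\<Sum>i<dim_vec v. (cmod (v $ i))\<^sup>2)"

lemma cscalar_prod_self: "v \<bullet>c v = of_real (sq_norm_cvec v)"
  by (simp add: scalar_prod_def sq_norm_cvec_def complex_norm_square atLeast0LessThan del: of_real_power)

lemma sq_norm_cvec_nonneg [simp]: "0 \<le> sq_norm_cvec v"
  by (simp add: sq_norm_cvec_def sum_nonneg)

lemma sq_norm_cvec_pos:
  assumes "v \<in> carrier_vec n" "v \<noteq> 0\<^sub>v n"
  shows "0 < sq_norm_cvec v"
proof -
  have "v \<bullet>c v \<noteq> 0" using conjugate_square_eq_0_vec[OF assms(1)] assms(2) by simp
  then have "sq_norm_cvec v \<noteq> 0" by (simp add: cscalar_prod_self)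
  then show ?thesis using sq_norm_cvec_nonneg[of v] by linarith
qed

lemma sq_norm_cvec_smult: "sq_norm_cvec (z \<cdot>\<^sub>v v) = (cmod z)\<^sup>2 * sq_norm_cvec v"
  by (simp add: sq_norm_cvec_def norm_mult power_mult_distrib sum_distrib_left)

text \<open>This is 0 \<le> \<parallel>v - s w\<parallel>^2 expanded, entry by entry. It replaces
  Cauchy-Schwarz below: a suitable weight \<open>s\<close> gives the same bounds without square
  roots.\<close>

lemma two_Re_cscalar_prod_le:
  assumes "dim_vec w = dim_vec v"
  shows "2 * s * Re (v \<bullet>c w) \<le> sq_norm_cvec v + s\<^sup>2 * sq_norm_cvec w"
proof -
  have *: "2 * s * Re (a * cnj b) \<le> (cmod a)\<^sup>2 + s\<^sup>2 * (cmod b)\<^sup>2" for a b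
    using zero_le_power2[of "Re a - s * Re b"] zero_le_power2[of "Im a - s * Im b"]
    unfolding cmod_power2 by (simp add: power2_eq_square algebra_simps)
  have "2 * s * Re (v \<bullet>c w) = (\<Sum>i<dim_vec v. 2 * s * Re (v $ i * cnj (w $ i)))"
    using assms by (simp add: scalar_prod_def atLeast0LessThan sum_distrib_left sum.distrib distrib_left)
  also have "\<dots> \<le> (\<Sum>i<dim_vec v. (cmod (v $ i))\<^sup>2 + s\<^sup>2 * (cmod (w $ i))\<^sup>2)"
    by (intro sum_mono *)
  finally show ?thesis
    using assms by (simp add: sq_norm_cvec_def sum.distrib sum_distrib_left)
qed

lemma mat_adjoint_carrier:
  "A \<in> carrier_mat m n \<Longrightarrow> mat_adjoint A \<in> carrier_mat n m"
  by (auto simp: mat_adjoint_def)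

lemma mult_mat_vec_index:
  assumes "A \<in> carrier_mat m n" "v \<in> carrier_vec n" "i < m"
  shows "(A *\<^sub>v v) $ i = (\<Sum>j<n. A $$ (i, j) * v $ j)"
  using assms by (auto simp: scalar_prod_def atLeast0LessThan)

lemma cscalar_prod_mat_adjoint:
  fixes A :: "complex mat"
  assumes A: "A \<in> carrier_mat m n" and v: "v \<in> carrier_vec n" and w: "w \<in> carrier_vec m"
  shows "(A *\<^sub>v v) \<bullet>c w = v \<bullet>c (mat_adjoint A *\<^sub>v w)"
proof -
  note B = mat_adjoint_carrier[OF A]
  have "(A *\<^sub>v v) \<bullet>c w = (\<Sum>i<m. (\<Sum>j<n. A $$ (i, j) * v $ j) * cnj (w $ i))"
    using A v w mult_mat_vec_index[OF A v] 
    by (auto simp: scalar_prod_def[of _ "conjugate w"] atLeast0LessThan simp del: index_mult_mat_vec)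
  also have "\<dots> = (\<Sum>j<n. v $ j * cnj (\<Sum>i<m. mat_adjoint A $$ (j, i) * w $ i))"
    unfolding cnj_sum sum_distrib_left sum_distrib_right
    using A by (subst sum.swap) (auto intro!: sum.cong simp: mat_adjoint_index)
  also have "\<dots> = v \<bullet>c (mat_adjoint A *\<^sub>v w)"
    using B v w mult_mat_vec_index[OF B w]
    by (auto simp: scalar_prod_def[of v] atLeast0LessThan simp del: index_mult_mat_vec)
  finally show ?thesis .
qed

lemma sq_norm_mult_mat_vec:
  assumes A: "A \<in> carrier_mat m n" and v: "v \<in> carrier_vec n"
  shows "v \<bullet>c ((mat_adjoint A * A) *\<^sub>v v) = of_real (sq_norm_cvec (A *\<^sub>v v))"
  using cscalar_prod_mat_adjoint[OF A v, of "A *\<^sub>v v"] A v mat_adjoint_carrier[OF A]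
  by (simp add: cscalar_prod_self)

section \<open>Growth of norms under powers of the Gram matrix\<close>

lemma Re_cscalar_prod_commute:
  assumes "dim_vec v = dim_vec w"
  shows "Re (v \<bullet>c w) = Re (w \<bullet>c v)"
  using assms by (simp add: scalar_prod_def algebra_simps)

text \<open>Along \<parallel>v\<parallel>^2, \<parallel>A v\<parallel>^2, \<parallel>u\<parallel>^2,
  \<parallel>A u\<parallel>^2 a growth factor of at least \<open>s\<close> persists. Each middle
  term is an inner product of its two neighbours' vectors, so the weighted bound with weight
  \<open>s\<close> applies. The second conclusion is the hypothesis again with \<open>u\<close> in
  place of \<open>v\<close>, which permits iteration.\<close>

lemma sq_norm_gram_growth:
  assumes A: "A \<in> carrier_mat m n" and v: "v \<in> carrier_vec n" and s: "0 \<le> s"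
    and le: "s * sq_norm_cvec v \<le> sq_norm_cvec (A *\<^sub>v v)"
  defines "u \<equiv> (mat_adjoint A * A) *\<^sub>v v"
  shows "s * sq_norm_cvec (A *\<^sub>v v) \<le> sq_norm_cvec u"
    and "s * sq_norm_cvec u \<le> sq_norm_cvec (A *\<^sub>v u)"
proof -
  note B = mat_adjoint_carrier[OF A]
  have u: "u \<in> carrier_vec n" using A B v by (auto simp: u_def)
  have u': "u = mat_adjoint A *\<^sub>v (A *\<^sub>v v)" using A B v by (simp add: u_def)
  have "Re (u \<bullet>c v) = sq_norm_cvec (A *\<^sub>v v)"
    using sq_norm_mult_mat_vec[OF A v] Re_cscalar_prod_commute[of u v] carrier_vecD[OF u] carrier_vecD[OF v]
    by (simp flip: u_def)
  then have "2 * s * sq_norm_cvec (A *\<^sub>v v) \<le> sq_norm_cvec u + s * (s * sq_norm_cvec v)"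
    using two_Re_cscalar_prod_le[of v u s] u v by (simp add: power2_eq_square mult.assoc)
  also have "\<dots> \<le> sq_norm_cvec u + s * sq_norm_cvec (A *\<^sub>v v)"
    using le s by (simp add: mult_left_mono)
  finally show 1: "s * sq_norm_cvec (A *\<^sub>v v) \<le> sq_norm_cvec u" by simp
  have "(A *\<^sub>v u) \<bullet>c (A *\<^sub>v v) = of_real (sq_norm_cvec u)"
    using cscalar_prod_mat_adjoint[OF A u, of "A *\<^sub>v v"] A v
    by (simp add: cscalar_prod_self flip: u')
  then have "2 * s * sq_norm_cvec u \<le> sq_norm_cvec (A *\<^sub>v u) + s * (s * sq_norm_cvec (A *\<^sub>v v))"
    using two_Re_cscalar_prod_le[of "A *\<^sub>v v" "A *\<^sub>v u" s] A
    by (simp add: power2_eq_square mult.assoc)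
  also have "\<dots> \<le> sq_norm_cvec (A *\<^sub>v u) + s * sq_norm_cvec u"
    using 1 s by (simp add: mult_left_mono)
  finally show "s * sq_norm_cvec u \<le> sq_norm_cvec (A *\<^sub>v u)" by simp
qed

lemma sq_norm_gram_power_ge:
  assumes A: "A \<in> carrier_mat m n" and v: "v \<in> carrier_vec n" and s: "0 \<le> s"
    and le: "s * sq_norm_cvec v \<le> sq_norm_cvec (A *\<^sub>v v)"
  shows "(s\<^sup>2) ^ k * sq_norm_cvec v \<le> sq_norm_cvec (((mat_adjoint A * A) ^\<^sub>m k) *\<^sub>v v)"
  using v le
\<comment> \<open>The induction starts from the inner end: \<open>v\<close> is replaced by
  \<open>B *\<^sub>v v\<close>, which satisfies the same growth hypothesis, and each such
  replacement gains a factor \<open>s\<^sup>2\<close>.\<close>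
proof (induction k arbitrary: v)
  case 0
  then show ?case using A mat_adjoint_carrier[OF A] by simp
next
  case (Suc k)
  define B where "B = mat_adjoint A * A"
  have B: "B \<in> carrier_mat n n" using A mat_adjoint_carrier[OF A] by (simp add: B_def)
  note g = sq_norm_gram_growth[OF A Suc.prems(1) s Suc.prems(2), folded B_def]
  have Bv: "B *\<^sub>v v \<in> carrier_vec n" using B Suc.prems by simp
  have "(s\<^sup>2) ^ Suc k * sq_norm_cvec v = (s\<^sup>2) ^ k * (s * (s * sq_norm_cvec v))"
    by (simp add: power2_eq_square)
  also have "\<dots> \<le> (s\<^sup>2) ^ k * (s * sq_norm_cvec (A *\<^sub>v v))"
    using Suc.prems(2) s by (intro mult_left_mono) auto
  also have "\<dots> \<le> (s\<^sup>2) ^ k * sq_norm_cvec (B *\<^sub>v v)"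
    using g(1) s by (intro mult_left_mono) auto
  also have "\<dots> \<le> sq_norm_cvec ((B ^\<^sub>m k) *\<^sub>v (B *\<^sub>v v))"
    using Suc.IH[OF Bv g(2)] by (simp add: B_def)
  also have "(B ^\<^sub>m k) *\<^sub>v (B *\<^sub>v v) = (B ^\<^sub>m Suc k) *\<^sub>v v"
    using B Suc.prems(1) assoc_mult_mat_vec[OF pow_carrier_mat[OF B] B] by simp
  finally show ?case by (simp add: B_def)
qed

section \<open>The spectral radius of the Gram matrix as a bound on \<parallel>A
  v\<parallel>^2\<close>

lemma norm_bound_sq_norm_le:
  assumes M: "M \<in> carrier_mat n n" and nb: "norm_bound M c" and v: "v \<in> carrier_vec n"
  shows "sq_norm_cvec (M *\<^sub>v v) \<le> real n * (\<Sum>j<n. c * cmod (v $ j))\<^sup>2"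
proof -
  have "cmod ((M *\<^sub>v v) $ i) \<le> (\<Sum>j<n. c * cmod (v $ j))" if i: "i < n" for i
    unfolding mult_mat_vec_index[OF M v i]
    using nb M i by (intro sum_norm_le) (auto simp: norm_bound_def norm_mult intro!: mult_right_mono)
  then have "(\<Sum>i<n. (cmod ((M *\<^sub>v v) $ i))\<^sup>2) \<le> (\<Sum>i<n. (\<Sum>j<n. c * cmod (v $ j))\<^sup>2)"
    by (intro sum_mono power_mono) auto
  then show ?thesis using M by (simp add: sq_norm_cvec_def)
qed

lemma sq_norm_mult_le_if_spectral_radius_less_1:
  assumes A: "A \<in> carrier_mat m n" and v: "v \<in> carrier_vec n"
    and sr: "spectral_radius (mat_adjoint A * A) < 1"
  shows "sq_norm_cvec (A *\<^sub>v v) \<le> sq_norm_cvec v"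
proof (rule ccontr)
  define B where "B = mat_adjoint A * A"
  have B: "B \<in> carrier_mat n n" using A mat_adjoint_carrier[OF A] by (simp add: B_def)
  obtain c where c: "\<And>k. norm_bound (B ^\<^sub>m k) c"
    using spectral_radius_jnf_norm_bound_less_1_upper_triangular[OF B] sr by (auto simp: B_def)
  \<comment> \<open>\<open>c\<close> bounds the entries of all powers at once, so \<open>K\<close>
    does not depend on the exponent.\<close>
  define K where "K = real n * (\<Sum>j<n. c * cmod (v $ j))\<^sup>2"
  assume "\<not> ?thesis"
  then have less: "sq_norm_cvec v < sq_norm_cvec (A *\<^sub>v v)" by simp
  have "v \<noteq> 0\<^sub>v n"
  proof
    assume "v = 0\<^sub>v n"
    then have "A *\<^sub>v v = 0\<^sub>v m" using A by (intro eq_vecI) auto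
    then have "sq_norm_cvec (A *\<^sub>v v) = 0" by (simp add: sq_norm_cvec_def)
    with less show False using sq_norm_cvec_nonneg[of v] by simp
  qed
  then have pos: "0 < sq_norm_cvec v" by (rule sq_norm_cvec_pos[OF v])
  \<comment> \<open>The quotient \<open>s\<close> satisfies the growth hypothesis with equality; as
    it exceeds 1, the lower bound on the powers is unbounded in \<open>k\<close> and must pass
    \<open>K\<close>.\<close>
  define s where "s = sq_norm_cvec (A *\<^sub>v v) / sq_norm_cvec v"
  have s: "1 < s" using less pos by (simp add: s_def)
  have "(s\<^sup>2) ^ k * sq_norm_cvec v \<le> K" for k
    using sq_norm_gram_power_ge[OF A v, of s k] norm_bound_sq_norm_le[OF pow_carrier_mat[OF B] c v, of k]
      s pos by (simp add: s_def K_def B_def)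
  moreover obtain k where "K / sq_norm_cvec v < (s\<^sup>2) ^ k"
    using real_arch_pow[of "s\<^sup>2"] s by (auto simp: one_less_power)
  ultimately show False using pos by (smt (verit) pos_divide_less_eq)
qed

text \<open>For an eigenvector \<open>u\<close> the eigenvalue equals \<parallel>A u\<parallel>^2 /
  \<parallel>u\<parallel>^2. This lets \<open>Re z\<close> in \<open>singular_values\<close> be
  exchanged for \<open>cmod z\<close> in the spectral radius.\<close>

lemma eigenvalue_gram_nonneg:
  assumes A: "A \<in> carrier_mat m n" and z: "eigenvalue (mat_adjoint A * A) z"
  shows "z = of_real (cmod z)"
proof -
  define B where "B = mat_adjoint A * A"
  have B: "B \<in> carrier_mat n n" using A mat_adjoint_carrier[OF A] by (simp add: B_def)
  obtain u where u: "u \<in> carrier_vec n" "u \<noteq> 0\<^sub>v n" "B *\<^sub>v u = z \<cdot>\<^sub>v u"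
    using z B by (auto simp: eigenvalue_def eigenvector_def B_def)
  have "u \<bullet>c (B *\<^sub>v u) = cnj z * of_real (sq_norm_cvec u)"
    using u by (simp add: conjugate_smult_vec cscalar_prod_self)
  then have "cnj z * of_real (sq_norm_cvec u) = of_real (sq_norm_cvec (A *\<^sub>v u))"
    using sq_norm_mult_mat_vec[OF A u(1)] by (simp add: B_def)
  then have "cnj z = of_real (sq_norm_cvec (A *\<^sub>v u) / sq_norm_cvec u)"
    using sq_norm_cvec_pos[OF u(1,2)] by (simp add: field_simps)
  then have "z = of_real (sq_norm_cvec (A *\<^sub>v u) / sq_norm_cvec u)"
    by (metis complex_cnj_cnj complex_cnj_complex_of_real)
  then show ?thesis by (metis abs_of_nonneg divide_nonneg_nonneg norm_of_real sq_norm_cvec_nonneg)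
qed

text \<open>Rescaling \<open>A\<close> by a real factor serves to push the spectral radius of the
  Gram matrix below 1.\<close>

lemma gram_smult:
  assumes A: "A \<in> carrier_mat m n"
  shows "mat_adjoint (of_real r \<cdot>\<^sub>m A) * (of_real r \<cdot>\<^sub>m A) = of_real (r\<^sup>2) \<cdot>\<^sub>m (mat_adjoint A * (A :: complex mat))"
proof -
  note B = mat_adjoint_carrier[OF A]
  have "mat_adjoint (of_real r \<cdot>\<^sub>m A) = of_real r \<cdot>\<^sub>m mat_adjoint A"
    using A B mat_adjoint_carrier[of "of_real r \<cdot>\<^sub>m A" m n]
    by (intro eq_matI) (auto simp: mat_adjoint_index)
  then show ?thesis
    using A B by (intro eq_matI) (auto simp: scalar_prod_def sum_distrib_left power2_eq_square ac_simps)
qed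

text \<open>For every \<open>t\<close> strictly above the spectral radius, dividing \<open>A\<close>
  by \<open>sqrt t\<close> reduces to the case of radius below 1. Letting \<open>t\<close> decrease
  to the radius gives the bound; the strict gap also keeps \<open>t\<close> positive when the radius
  is 0.\<close>

lemma sq_norm_mult_le_spectral_radius:
  assumes A: "A \<in> carrier_mat m n" and n: "0 < n" and v: "v \<in> carrier_vec n"
  shows "sq_norm_cvec (A *\<^sub>v v) \<le> spectral_radius (mat_adjoint A * A) * sq_norm_cvec v"
proof -
  define B where "B = mat_adjoint A * A"
  have B: "B \<in> carrier_mat n n" using A mat_adjoint_carrier[OF A] by (simp add: B_def)
  have sr0: "0 \<le> spectral_radius B"
    using spectral_radius_mem_max(1)[OF B n] by auto
  have *: "sq_norm_cvec (A *\<^sub>v v) \<le> t * sq_norm_cvec v" if t: "spectral_radius B < t" for t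
  proof -
    define r where "r = 1 / sqrt t"
    have t0: "0 < t" using t sr0 by simp
    then have r2: "r\<^sup>2 = 1 / t" by (simp add: r_def power_divide)
    define A' where "A' = of_real r \<cdot>\<^sub>m A"
    have A': "A' \<in> carrier_mat m n" using A by (simp add: A'_def)
    define B' where "B' = mat_adjoint A' * A'"
    have B'eq: "B' = of_real (1 / t) \<cdot>\<^sub>m B"
      unfolding B'_def A'_def gram_smult[OF A] r2 B_def ..
    have B': "B' \<in> carrier_mat n n" using B by (simp add: B'eq)
    obtain z where z: "eigenvalue B' z" "spectral_radius B' = cmod z"
      using spectral_radius_mem_max(1)[OF B' n] by (auto simp: spectrum_def)
    obtain u where u: "u \<in> carrier_vec n" "u \<noteq> 0\<^sub>v n" "B' *\<^sub>v u = z \<cdot>\<^sub>v u"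
      using z(1) B' by (auto simp: eigenvalue_def eigenvector_def)
    \<comment> \<open>Undoing the scaling turns the dominant eigenvalue \<open>z\<close> of
      \<open>B'\<close> into the eigenvalue \<open>t * z\<close> of \<open>B\<close>, hence
      \<open>t * cmod z < t\<close>.\<close>
    have "B *\<^sub>v u = (of_real t * z) \<cdot>\<^sub>v u"
    proof -
      have "B = of_real t \<cdot>\<^sub>m B'" using t0 B by (intro eq_matI) (auto simp: B'eq)
      then have "B *\<^sub>v u = of_real t \<cdot>\<^sub>v (B' *\<^sub>v u)" using B' u(1) by auto
      then show ?thesis by (simp add: u(3) smult_smult_assoc)
    qed
    then have "eigenvalue B (of_real t * z)"
      using u B by (auto simp: eigenvalue_def eigenvector_def)
    then have "cmod (of_real t * z) \<le> spectral_radius B"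
      by (intro spectral_radius_mem_max(2)[OF B n]) (auto simp: spectrum_def)
    then have "t * cmod z \<le> spectral_radius B" using t0 by (simp add: norm_mult)
    then have "t * cmod z < t" using t by linarith
    then have "spectral_radius B' < 1" using t0 z(2) mult_less_cancel_left_pos[OF t0, of "cmod z" 1] by simp
    then have "sq_norm_cvec (A' *\<^sub>v v) \<le> sq_norm_cvec v"
      using sq_norm_mult_le_if_spectral_radius_less_1[OF A' v] by (simp add: B'_def)
    moreover have "A' *\<^sub>v v = of_real r \<cdot>\<^sub>v (A *\<^sub>v v)" using A v by (auto simp: A'_def)
    ultimately have "1 / t * sq_norm_cvec (A *\<^sub>v v) \<le> sq_norm_cvec v"
      by (simp add: sq_norm_cvec_smult r2)
    then show ?thesis using t0 by (simp add: pos_divide_le_eq mult.commute)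
  qed
  show ?thesis
  proof (cases "sq_norm_cvec v = 0")
    case True
    then show ?thesis using *[of "spectral_radius B + 1"] by simp
  next
    case False
    then have pos: "0 < sq_norm_cvec v" using sq_norm_cvec_nonneg[of v] by linarith
    have "sq_norm_cvec (A *\<^sub>v v) / sq_norm_cvec v \<le> spectral_radius B"
    proof (rule dense_ge)
      fix t assume "spectral_radius B < t"
      from *[OF this] show "sq_norm_cvec (A *\<^sub>v v) / sq_norm_cvec v \<le> t"
        using pos by (simp add: pos_divide_le_eq)
    qed
    then show ?thesis using pos by (simp add: pos_divide_le_eq B_def)
  qed
qed

text \<open>The spectral radius is attained at an eigenvalue of \<open>A\<^sup>\<dagger> A\<close>,
  and the square root of that eigenvalue is the required singular value.\<close>

lemma ex_singular_value_ge:
  assumes A: "A \<in> carrier_mat m n" and n: "0 < n" and v: "v \<in> carrier_vec n"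
    and s: "0 \<le> s" and le: "s\<^sup>2 * sq_norm_cvec v \<le> sq_norm_cvec (A *\<^sub>v v)" "0 < sq_norm_cvec v"
  shows "\<exists>x \<in> set (singular_values A). s \<le> x"
proof -
  define B where "B = mat_adjoint A * A"
  have B: "B \<in> carrier_mat n n" using A mat_adjoint_carrier[OF A] by (simp add: B_def)
  obtain z where z: "eigenvalue B z" "spectral_radius B = cmod z"
    using spectral_radius_mem_max(1)[OF B n] by (auto simp: spectrum_def)
  have "Re z = cmod z" using eigenvalue_gram_nonneg[OF A] z(1) by (metis B_def Re_complex_of_real)
  moreover have "s\<^sup>2 * sq_norm_cvec v \<le> spectral_radius B * sq_norm_cvec v"
    using le(1) sq_norm_mult_le_spectral_radius[OF A n v] by (simp add: B_def)
  ultimately have "s \<le> sqrt (Re z)" using le(2) z(2) by (intro real_le_rsqrt) simp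
  \<comment> \<open>Nonvanishing is what makes membership in \<open>proots\<close> the same as being
    a root.\<close>
  moreover have "char_poly B \<noteq> 0" using degree_monic_char_poly[OF B] by auto
  then have "z \<in># proots (char_poly B)"
    using z(1) eigenvalue_root_char_poly[OF B] by simp
  then have "sqrt (Re z) \<in> set (singular_values A)"
    by (auto simp: singular_values_def B_def)
  ultimately show ?thesis by blast
qed

section \<open>The least operator Schmidt coefficient\<close>

text \<open>In a decreasing list every entry is at least the last one. Only one position
  \<open>k\<close> holding \<open>x\<close> is set aside, so repeated values do no harm.\<close>

lemma sum_list_ge_member_plus_last:
  fixes xs :: "real list"
  assumes "sorted (rev xs)" "x \<in> set xs"
  shows "x + real (length xs - 1) * xs ! (length xs - 1) \<le> sum_list xs"
proof -
  obtain k where k: "k < length xs" "x = xs ! k" using assms(2) by (auto simp: in_set_conv_nth)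
  have "real (length xs - 1) * xs ! (length xs - 1)
      = (\<Sum>i\<in>{..<length xs} - {k}. xs ! (length xs - 1))"
    using k by simp
  also have "\<dots> \<le> (\<Sum>i\<in>{..<length xs} - {k}. xs ! i)"
    using assms(1) by (intro sum_mono) (auto simp: sorted_rev_iff_nth_mono)
  finally show ?thesis
    using k by (simp add: sum_list_sum_nth atLeast0LessThan sum.remove[of _ k])
qed

section \<open>Expanding the identity in operator bases\<close>

lemma hs_inner_eq_sum:
  assumes "C \<in> carrier_mat m n" "D \<in> carrier_mat m n"
  shows "hs_inner C D = (\<Sum>a<n. \<Sum>b<m. cnj (C $$ (b, a)) * D $$ (b, a))"
proof -
  have "mat_adjoint C \<in> carrier_mat n m" using assms(1) by (rule mat_adjoint_carrier)
  then show ?thesis using assms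
    by (auto simp: hs_inner_def mtrace_def scalar_prod_def mat_adjoint_index atLeast0LessThan)
qed

text \<open>The delta is kept under \<open>cnj\<close> so that it can afterwards be replaced by a
  basis expansion of the identity.\<close>

lemma sum_cnj_delta:
  fixes f :: "nat \<Rightarrow> complex"
  assumes "a < n"
  shows "(\<Sum>b<n. cnj (if b = a then 1 else 0) * f b) = f a"
proof -
  have "(\<Sum>b<n. cnj (if b = a then 1 else 0) * f b) = (\<Sum>b<n. if b = a then f b else 0)"
    by (intro sum.cong) auto
  then show ?thesis using assms by simp
qed

text \<open>Spanning supplies the coefficients; their squared norm is Parseval's identity for the
  identity matrix, whose Hilbert-Schmidt norm squared is \<open>d\<close>.\<close>

lemma hs_orthonormal_basis_expand_one:
  assumes F: "hs_orthonormal_basis d F"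
  obtains c where "\<And>a b. a < d \<Longrightarrow> b < d \<Longrightarrow> (\<Sum>i<d\<^sup>2. c i * F i $$ (a, b)) = (if a = b then 1 else 0)"
    and "(\<Sum>i<d\<^sup>2. (cmod (c i))\<^sup>2) = real d"
proof -
  obtain c where c: "1\<^sub>m d = mat d d (\<lambda>(a, b). \<Sum>i<d\<^sup>2. c i * F i $$ (a, b))"
    using F one_carrier_mat[of d] unfolding hs_orthonormal_basis_def by blast
  have F_car: "F i \<in> carrier_mat d d" if "i < d\<^sup>2" for i
    using F that by (auto simp: hs_orthonormal_basis_def)
  have entry: "(\<Sum>i<d\<^sup>2. c i * F i $$ (a, b)) = (if a = b then 1 else 0)" if "a < d" "b < d" for a b
    using arg_cong[OF c, of "\<lambda>M. M $$ (a, b)"] that by simp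
  have "of_nat d = (\<Sum>a<d. \<Sum>b<d. cnj (if b = a then 1 else 0) * (if b = a then 1 else 0 :: complex))"
    by (simp add: sum_cnj_delta)
  also have "\<dots> = (\<Sum>a<d. \<Sum>b<d. cnj (\<Sum>i<d\<^sup>2. c i * F i $$ (b, a)) * (\<Sum>j<d\<^sup>2. c j * F j $$ (b, a)))"
    by (intro sum.cong refl) (simp add: entry)
  also have "\<dots> = (\<Sum>a<d. \<Sum>b<d. \<Sum>i<d\<^sup>2. \<Sum>j<d\<^sup>2. cnj (c i) * c j * (cnj (F i $$ (b, a)) * F j $$ (b, a)))"
    unfolding cnj_sum sum_product complex_cnj_mult by (intro sum.cong refl) (simp only: mult_ac)
  \<comment> \<open>The swaps move the entry indices \<open>a\<close> and \<open>b\<close>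
    innermost, where they form \<open>hs_inner (F i) (F j)\<close>.\<close>
  also have "\<dots> = (\<Sum>a<d. \<Sum>i<d\<^sup>2. \<Sum>b<d. \<Sum>j<d\<^sup>2. cnj (c i) * c j * (cnj (F i $$ (b, a)) * F j $$ (b, a)))"
    by (intro sum.cong refl sum.swap)
  also have "\<dots> = (\<Sum>i<d\<^sup>2. \<Sum>a<d. \<Sum>b<d. \<Sum>j<d\<^sup>2. cnj (c i) * c j * (cnj (F i $$ (b, a)) * F j $$ (b, a)))"
    by (rule sum.swap)
  also have "\<dots> = (\<Sum>i<d\<^sup>2. \<Sum>a<d. \<Sum>j<d\<^sup>2. \<Sum>b<d. cnj (c i) * c j * (cnj (F i $$ (b, a)) * F j $$ (b, a)))"
    by (intro sum.cong refl sum.swap)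
  also have "\<dots> = (\<Sum>i<d\<^sup>2. \<Sum>j<d\<^sup>2. \<Sum>a<d. \<Sum>b<d. cnj (c i) * c j * (cnj (F i $$ (b, a)) * F j $$ (b, a)))"
    by (intro sum.cong refl sum.swap)
  also have "\<dots> = (\<Sum>i<d\<^sup>2. \<Sum>j<d\<^sup>2. cnj (c i) * c j * hs_inner (F i) (F j))"
    by (intro sum.cong refl) (simp add: hs_inner_eq_sum[OF F_car F_car] sum_distrib_left)
  also have "\<dots> = (\<Sum>i<d\<^sup>2. \<Sum>j<d\<^sup>2. if i = j then cnj (c i) * c j else 0)"
    using F by (intro sum.cong refl) (auto simp: hs_orthonormal_basis_def)
  also have "\<dots> = of_real (\<Sum>i<d\<^sup>2. (cmod (c i))\<^sup>2)"
    by (simp add: complex_norm_square mult.commute del: of_real_power)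
  finally have "complex_of_real (real d) = of_real (\<Sum>i<d\<^sup>2. (cmod (c i))\<^sup>2)" by simp
  then have "(\<Sum>i<d\<^sup>2. (cmod (c i))\<^sup>2) = real d" unfolding of_real_eq_iff by simp
  with entry show ?thesis by (rule that)
qed

lemma ex_op_schmidt_coeff_ge:
  assumes d: "0 < d" and \<rho>: "\<rho> \<in> carrier_mat (d * d) (d * d)" "mtrace \<rho> = 1"
    and F: "hs_orthonormal_basis d F" and G: "hs_orthonormal_basis d G"
  shows "\<exists>x \<in> set (op_schmidt_coeffs d F G \<rho>). 1 / real d \<le> x"
proof -
  define C where "C = correlation_mat d F G \<rho>"
  have C: "C \<in> carrier_mat (d\<^sup>2) (d\<^sup>2)" by (simp add: C_def correlation_mat_def)
  obtain c where c: "\<And>a b. a < d \<Longrightarrow> b < d \<Longrightarrow> (\<Sum>i<d\<^sup>2. c i * F i $$ (a, b)) = (if a = b then 1 else 0)"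
      "(\<Sum>i<d\<^sup>2. (cmod (c i))\<^sup>2) = real d"
    using hs_orthonormal_basis_expand_one[OF F] by blast
  obtain e where e: "\<And>a b. a < d \<Longrightarrow> b < d \<Longrightarrow> (\<Sum>i<d\<^sup>2. e i * G i $$ (a, b)) = (if a = b then 1 else 0)"
      "(\<Sum>i<d\<^sup>2. (cmod (e i))\<^sup>2) = real d"
    using hs_orthonormal_basis_expand_one[OF G] by blast
  have F_car: "F i \<in> carrier_mat d d" and G_car: "G i \<in> carrier_mat d d" if "i < d\<^sup>2" for i
    using F G that by (auto simp: hs_orthonormal_basis_def)
  \<comment> \<open>The entries of \<open>C\<close> conjugate the basis operators, so both
    coefficient families must enter conjugated. The product \<open>\<bullet>c\<close> already
    conjugates its second argument, so only \<open>v\<close> is conjugated by hand.\<close>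
  define v where "v = vec (d\<^sup>2) (\<lambda>j. cnj (e j))"
  define w where "w = vec (d\<^sup>2) c"
  have v: "v \<in> carrier_vec (d\<^sup>2)" and w: "w \<in> carrier_vec (d\<^sup>2)" by (auto simp: v_def w_def)
  have Nv: "sq_norm_cvec v = real d" and Nw: "sq_norm_cvec w = real d"
    using c(2) e(2) by (simp_all add: sq_norm_cvec_def v_def w_def)
  let ?K = "\<lambda>i j. kron (F i) (G j)"
  have K_car: "?K i j \<in> carrier_mat (d * d) (d * d)" if "i < d\<^sup>2" "j < d\<^sup>2" for i j
    using F_car[OF that(1)] G_car[OF that(2)] by (auto simp: kron_def)
  \<comment> \<open>Entries of a Kronecker product factor over quotient and remainder by
    \<open>d\<close>, so the double sum is the product of the two expansions of the
    identity.\<close>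
  have one: "(\<Sum>i<d\<^sup>2. \<Sum>j<d\<^sup>2. c i * e j * ?K i j $$ (y, x)) = (if y = x then 1 else 0)"
    if "x < d * d" "y < d * d" for x y
  proof -
    have less: "x div d < d" "y div d < d" "x mod d < d" "y mod d < d"
      using that d by (auto simp: less_mult_imp_div_less)
    have "(\<Sum>i<d\<^sup>2. \<Sum>j<d\<^sup>2. c i * e j * ?K i j $$ (y, x))
      = (\<Sum>i<d\<^sup>2. \<Sum>j<d\<^sup>2. (c i * F i $$ (y div d, x div d)) * (e j * G j $$ (y mod d, x mod d)))"
    proof (intro sum.cong refl)
      fix i j assume "i \<in> {..<d\<^sup>2}" "j \<in> {..<d\<^sup>2}"
      then show "c i * e j * ?K i j $$ (y, x)
          = (c i * F i $$ (y div d, x div d)) * (e j * G j $$ (y mod d, x mod d))"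
        using F_car[of i] G_car[of j] that by (auto simp: kron_def)
    qed
    also have "\<dots> = (\<Sum>i<d\<^sup>2. c i * F i $$ (y div d, x div d)) * (\<Sum>j<d\<^sup>2. e j * G j $$ (y mod d, x mod d))"
      by (simp add: sum_product)
    also have "\<dots> = (if y div d = x div d \<and> y mod d = x mod d then 1 else 0)"
      using c(1) e(1) less by simp
    also have "y div d = x div d \<and> y mod d = x mod d \<longleftrightarrow> y = x"
      by (metis div_mult_mod_eq)
    finally show ?thesis .
  qed
  have "1 = (\<Sum>x<d * d. \<Sum>y<d * d. cnj (if y = x then 1 else 0) * \<rho> $$ (y, x))"
    using \<rho> by (simp add: mtrace_def sum_cnj_delta)
  also have "\<dots> = (\<Sum>x<d * d. \<Sum>y<d * d.
      cnj (\<Sum>i<d\<^sup>2. \<Sum>j<d\<^sup>2. c i * e j * ?K i j $$ (y, x)) * \<rho> $$ (y, x))"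
    by (intro sum.cong refl) (simp add: one)
  also have "\<dots> = (\<Sum>x<d * d. \<Sum>y<d * d. \<Sum>i<d\<^sup>2. \<Sum>j<d\<^sup>2.
      cnj (c i) * cnj (e j) * (cnj (?K i j $$ (y, x)) * \<rho> $$ (y, x)))"
    by (simp add: sum_distrib_right mult.assoc)
  also have "\<dots> = (\<Sum>x<d * d. \<Sum>i<d\<^sup>2. \<Sum>y<d * d. \<Sum>j<d\<^sup>2.
      cnj (c i) * cnj (e j) * (cnj (?K i j $$ (y, x)) * \<rho> $$ (y, x)))"
    by (intro sum.cong refl sum.swap)
  also have "\<dots> = (\<Sum>i<d\<^sup>2. \<Sum>x<d * d. \<Sum>y<d * d. \<Sum>j<d\<^sup>2.
      cnj (c i) * cnj (e j) * (cnj (?K i j $$ (y, x)) * \<rho> $$ (y, x)))"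
    by (rule sum.swap)
  also have "\<dots> = (\<Sum>i<d\<^sup>2. \<Sum>x<d * d. \<Sum>j<d\<^sup>2. \<Sum>y<d * d.
      cnj (c i) * cnj (e j) * (cnj (?K i j $$ (y, x)) * \<rho> $$ (y, x)))"
    by (intro sum.cong refl sum.swap)
  also have "\<dots> = (\<Sum>i<d\<^sup>2. \<Sum>j<d\<^sup>2. \<Sum>x<d * d. \<Sum>y<d * d.
      cnj (c i) * cnj (e j) * (cnj (?K i j $$ (y, x)) * \<rho> $$ (y, x)))"
    by (intro sum.cong refl sum.swap)
  also have "\<dots> = (\<Sum>i<d\<^sup>2. \<Sum>j<d\<^sup>2. cnj (c i) * cnj (e j) * C $$ (i, j))"
    by (intro sum.cong refl)
      (simp add: C_def correlation_mat_def hs_inner_eq_sum[OF K_car \<rho>(1)] sum_distrib_left)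
  also have "\<dots> = (\<Sum>i<d\<^sup>2. (\<Sum>j<d\<^sup>2. C $$ (i, j) * v $ j) * cnj (w $ i))"
    by (simp add: v_def w_def sum_distrib_left sum_distrib_right ac_simps)
  also have "\<dots> = (C *\<^sub>v v) \<bullet>c w"
    using C v w mult_mat_vec_index[OF C v]
    by (auto simp: scalar_prod_def[of _ "conjugate w"] atLeast0LessThan simp del: index_mult_mat_vec)
  finally have "Re ((C *\<^sub>v v) \<bullet>c w) = 1" by simp
  \<comment> \<open>The weight \<open>1 / d\<close> maximizes \<open>2 * s - s\<^sup>2 * d\<close>,
    where \<open>d\<close> is the squared norm of \<open>w\<close>. It yields \<parallel>C
    v\<parallel>^2 \<ge> 1/d, which is (1/d)^2 times the squared norm of \<open>v\<close>.\<close>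
  then have "2 * (1 / real d) \<le> sq_norm_cvec (C *\<^sub>v v) + (1 / real d)\<^sup>2 * real d"
    using two_Re_cscalar_prod_le[of w "C *\<^sub>v v" "1 / real d"] C w Nw by simp
  then have "(1 / real d)\<^sup>2 * sq_norm_cvec v \<le> sq_norm_cvec (C *\<^sub>v v)"
    using d by (simp add: Nv power2_eq_square)
  then show ?thesis
    using ex_singular_value_ge[OF C _ v, of "1 / real d"] d Nv
    by (simp add: op_schmidt_coeffs_def C_def)
qed

section \<open>Estimates for \<open>r_CN\<close> and the conclusion\<close>

lemma r_CN_less:
  assumes "d \<ge> 1"
  shows "r_CN d < 1 / (real d)\<^sup>2"
proof -
  define x where "x = real d"
  have x: "1 \<le> x" using assms by (simp add: x_def)
  have den: "0 < x * (x\<^sup>2 - 1)\<^sup>2 + x ^ 3" using x by (intro add_nonneg_pos) auto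
  have "x\<^sup>2 * (x * (x\<^sup>2 - 1) - sqrt (x\<^sup>2 - 1)) \<le> x\<^sup>2 * (x * (x\<^sup>2 - 1))"
    using x by (intro mult_left_mono) auto
  \<comment> \<open>With the square root dropped, the right side exceeds the left by exactly
    \<open>x\<close>.\<close>
  also have "\<dots> < x * (x\<^sup>2 - 1)\<^sup>2 + x ^ 3"
    using x by (simp add: power2_eq_square power3_eq_cube algebra_simps)
  finally show ?thesis
    using x den unfolding r_CN_def x_def[symmetric] by (simp add: field_simps)
qed

lemma inverse_times_succ_le_r_CN:
  assumes "d \<ge> 3"
  shows "1 / (real d * (real d + 1)) \<le> r_CN d"
proof -
  define x where "x = real d"
  have x: "3 \<le> x" using assms by (simp add: x_def)
  have den: "0 < x * (x\<^sup>2 - 1)\<^sup>2 + x ^ 3" using x by (intro add_nonneg_pos) auto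
  have sq: "sqrt (x\<^sup>2 - 1) \<le> x" using x by (intro real_le_lsqrt) auto
  \<comment> \<open>After bounding the square root by \<open>x\<close> and clearing denominators,
    what remains is \<open>x\<close> times the cubic x^3 - x^2 - 2x - 1. Division by
    \<open>x - 3\<close> with remainder 11 shows its sign for x \<ge> 3; at x = 2 the cubic is
    -1.\<close>
  have "0 \<le> x * ((x - 3) * (x\<^sup>2 + 2 * x + 4) + 11)"
    using x by (intro mult_nonneg_nonneg add_nonneg_nonneg) auto
  then have "x * (x\<^sup>2 - 1)\<^sup>2 + x ^ 3 \<le> x * (x + 1) * (x * (x\<^sup>2 - 1) - x)"
    by (simp add: power2_eq_square power3_eq_cube algebra_simps)
  also have "\<dots> \<le> x * (x + 1) * (x * (x\<^sup>2 - 1) - sqrt (x\<^sup>2 - 1))"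
    using sq x by (intro mult_left_mono) auto
  finally show ?thesis
    using x den unfolding r_CN_def x_def[symmetric]
    by (simp add: pos_le_divide_eq pos_divide_le_eq mult.commute)
qed

theorem theorem3:
  fixes d :: nat
  assumes "d \<ge> 1"
  shows "(d \<ge> 3 \<longrightarrow>
            (\<forall>\<rho> F G. density_operator (d * d) \<rho> \<longrightarrow>
               hs_orthonormal_basis d F \<longrightarrow> hs_orthonormal_basis d G \<longrightarrow>
               sum_list (op_schmidt_coeffs d F G \<rho>) \<le> 1 \<longrightarrow>
               op_schmidt_coeffs d F G \<rho> ! (d\<^sup>2 - 1) \<le> r_CN d)) \<and>
         r_CN d < 1 / (real d)\<^sup>2"
proof (intro conjI impI allI)
  show "r_CN d < 1 / (real d)\<^sup>2" using assms by (rule r_CN_less)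
next
  fix \<rho> F G
  assume d: "d \<ge> 3" and \<rho>: "density_operator (d * d) \<rho>"
    and F: "hs_orthonormal_basis d F" and G: "hs_orthonormal_basis d G"
    and sum: "sum_list (op_schmidt_coeffs d F G \<rho>) \<le> 1"
  let ?r = "op_schmidt_coeffs d F G \<rho>"
  obtain x where x: "x \<in> set ?r" "1 / real d \<le> x"
    using ex_op_schmidt_coeff_ge[OF _ _ _ F G, of \<rho>] \<rho> d by (auto simp: density_operator_def)
  have "sorted (rev ?r)" by (simp add: op_schmidt_coeffs_def singular_values_def)
  from sum_list_ge_member_plus_last[OF this x(1)]
  have "1 / real d + real (d\<^sup>2 - 1) * ?r ! (d\<^sup>2 - 1) \<le> 1"
    using x(2) sum by (simp add: length_op_schmidt_coeffs)
  moreover have "real (d\<^sup>2 - 1) = (real d + 1) * (real d - 1)"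
    using d by (simp add: of_nat_diff algebra_simps power2_eq_square)
  \<comment> \<open>Since 1 - 1/d = (d - 1)/d, both sides carry the positive factor
    \<open>d - 1\<close>, which is isolated here in order to be cancelled.\<close>
  ultimately have "(real d - 1) * (real d * (real d + 1) * ?r ! (d\<^sup>2 - 1)) \<le> (real d - 1) * 1"
    using d by (simp add: field_simps)
  then have "real d * (real d + 1) * ?r ! (d\<^sup>2 - 1) \<le> 1"
    using d by (subst (asm) mult_le_cancel_left_pos) auto
  then have "?r ! (d\<^sup>2 - 1) \<le> 1 / (real d * (real d + 1))"
    using d by (simp add: pos_le_divide_eq mult.commute)
  also have "\<dots> \<le> r_CN d" using d by (rule inverse_times_succ_le_r_CN)
  finally show "?r ! (d\<^sup>2 - 1) \<le> r_CN d" .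
qed

end
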